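(* Let $\mathcal{P}\subseteq\mathbb{R}^{n+m}$ be a proper cone with dual cone $\mathcal{P}^*$. Let $A\in\mathbb{R}^{n\times n}$ and $B\in\mathbb{R}^{n\times m}$, and suppose that for every $(x,u)\in\mathcal{P}$ there exists $v\in\mathbb{R}^m$ such that $(Ax+Bu,v)\in\mathcal{P}$. Let $(s,r)\in\mathbb{R}^n\times\mathbb{R}^m$ be an interior point of $\mathcal{P}^*$. Moreover, assume that there exists a function $\phi:\mathbb{R}^m\to\mathbb{R}^n$ such that $$\phi(\mu)^\top x=\min_{u:\,(x,u)\in\mathcal{P}}\mu^\top u$$ for all $(x,v)\in\mathcal{P}$ and all $(\eta,\mu)\in\mathcal{P}^*$. For $x_0\in\mathbb{R}^n$, consider the optimal control problem $$\text{Minimize } \sum_{t=0}^\infty\left[s^\top x(t)+r^\top u(t)\right]\ \text{ over } \{u(t)\}_{t=0}^\infty$$ $$\text{subject to } x(t+1)=Ax(t)+Bu(t),\quad (x(t),u(t))\in\mathcal{P}\ \text{ for all } t\ge 0,\quad x(0)=x_0. \qquad (\mathrm{OC})$$ Then the following three statements are equivalent: (i) The problem (OC) has a finite value for all $(x_0,u_0)\in\mathcal{P}$. (ii) There exists $(\lambda_*,0)\in\mathcal{P}^*$ such that $$\lambda_*=s+A^\top\lambda_*+\phi(r+B^\top\lambda_* ).$$ (iii) The convex program $$\text{Maximize } \lambda^\top x_0\ \text{ over } (\lambda,0)\in\mathcal{P}^*\quad\text{subject to } (s+A^\top\lambda-\lambda,\; r+B^\top\lambda)\in\mathcal{P}^*$$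 has a bounded value for every $(x_0,u_0)\in\mathcal{P}$. If (ii) is true, then the minimal value of the problem (OC) in (i) and the maximal value of the convex program in (iii) are both equal to $\lambda_*^\top x_0$. Moreover, the optimal control law $x\mapsto u$ for (OC) is obtained by minimizing $(r+B^\top\lambda_* )^\top u$ over $u$ subject to the constraint $(x,u)\in\mathcal{P}$.
   Context: A cone $\mathcal{P}\subseteq\mathbb{R}^N$ is called proper if it is convex, closed, pointed and has non-empty interior. The dual cone of $\mathcal{P}$ is $\mathcal{P}^*=\{\lambda\in\mathbb{R}^N:\lambda^\top x\ge 0\text{ for all }x\in\mathcal{P}\}$. Elements of $\mathbb{R}^{n+m}$ are written as pairs $(x,u)$ with $x\in\mathbb{R}^n$, $u\in\mathbb{R}^m$, and likewise elements of $\mathcal{P}^*$ are written $(\eta,\mu)$ with $\eta\in\mathbb{R}^n$, $\mu\in\mathbb{R}^m$; the pairing is $\eta^\top x+\mu^\top u$. In the minimization defining $\phi$ (and in the control law), $x$ is fixed and the minimization is over $u$ only. In (i) and (iii), the quantification over $(x_0,u_0)\in\mathcal{P}$ means over all $x_0\in\mathbb{R}^n$ for which some $u_0\in\mathbb{R}^m$ with $(x_0,u_0)\in\mathcal{P}$ exists; $u_0$ does not otherwise enter the problems. *)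

theory Defs
  imports "HOL-Analysis.Analysis"
begin

definition proper_cone :: "'a::euclidean_space set \<Rightarrow> bool" where
  "proper_cone P \<longleftrightarrow>
     cone P \<and> convex P \<and> closed P \<and> (\<forall>z. z \<in> P \<and> - z \<in> P \<longrightarrow> z = 0) \<and> interior P \<noteq> {}"

definition dual_cone :: "'a::real_inner set \<Rightarrow> 'a set" where
  "dual_cone P = {l. \<forall>z\<in>P. 0 \<le> l \<bullet> z}"

definition oc_feasible ::
  "real^'n^'n \<Rightarrow> real^'m^'n \<Rightarrow> ((real^'n) \<times> (real^'m)) set \<Rightarrow> real^'n
     \<Rightarrow> (nat \<Rightarrow> real^'n) \<times> (nat \<Rightarrow> real^'m) \<Rightarrow> bool" where
  "oc_feasible A B P x0 = (\<lambda>(x, u).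
     x 0 = x0 \<and> (\<forall>t. x (Suc t) = A *v x t + B *v u t \<and> (x t, u t) \<in> P))"

text \<open>The cost is extended-real-valued so that a divergent series has cost \<open>\<infinity>\<close>. It is meaningful
  for nonnegative stage costs, hence on every feasible trajectory when \<open>(s, r) \<in> dual_cone P\<close>.\<close>

definition oc_cost ::
  "real^'n \<Rightarrow> real^'m \<Rightarrow> (nat \<Rightarrow> real^'n) \<times> (nat \<Rightarrow> real^'m) \<Rightarrow> ereal" where
  "oc_cost s r = (\<lambda>(x, u). \<Sum>t. ereal (s \<bullet> x t + r \<bullet> u t))"

definition oc_value ::
  "real^'n^'n \<Rightarrow> real^'m^'n \<Rightarrow> ((real^'n) \<times> (real^'m)) set \<Rightarrow> real^'n \<Rightarrow> real^'m \<Rightarrow> real^'n \<Rightarrow> ereal" where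
  "oc_value A B P s r x0 = (INF z \<in> {z. oc_feasible A B P x0 z}. oc_cost s r z)"

definition oc_optimal ::
  "real^'n^'n \<Rightarrow> real^'m^'n \<Rightarrow> ((real^'n) \<times> (real^'m)) set \<Rightarrow> real^'n \<Rightarrow> real^'m \<Rightarrow> real^'n
     \<Rightarrow> (nat \<Rightarrow> real^'n) \<times> (nat \<Rightarrow> real^'m) \<Rightarrow> bool" where
  "oc_optimal A B P s r x0 = is_arg_min (oc_cost s r) (oc_feasible A B P x0)"

primrec closed_loop ::
  "real^'n^'n \<Rightarrow> real^'m^'n \<Rightarrow> (real^'n \<Rightarrow> real^'m) \<Rightarrow> real^'n \<Rightarrow> nat \<Rightarrow> real^'n" where
  "closed_loop A B \<kappa> x0 0 = x0"
| "closed_loop A B \<kappa> x0 (Suc t) =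
     A *v closed_loop A B \<kappa> x0 t + B *v \<kappa> (closed_loop A B \<kappa> x0 t)"

text \<open>A law is optimal if, from every admissible initial state, its closed-loop trajectory is an
  optimal one. Values of \<open>\<kappa>\<close> outside \<open>fst ` P\<close> are irrelevant.\<close>

definition optimal_control_law ::
  "real^'n^'n \<Rightarrow> real^'m^'n \<Rightarrow> ((real^'n) \<times> (real^'m)) set \<Rightarrow> real^'n \<Rightarrow> real^'m
     \<Rightarrow> (real^'n \<Rightarrow> real^'m) \<Rightarrow> bool" where
  "optimal_control_law A B P s r \<kappa> \<longleftrightarrow>
     (\<forall>(x0, u0)\<in>P. oc_optimal A B P s r x0
        (closed_loop A B \<kappa> x0, \<lambda>t. \<kappa> (closed_loop A B \<kappa> x0 t)))"

definition cp_feasible ::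
  "real^'n^'n \<Rightarrow> real^'m^'n \<Rightarrow> ((real^'n) \<times> (real^'m)) set \<Rightarrow> real^'n \<Rightarrow> real^'m \<Rightarrow> real^'n \<Rightarrow> bool" where
  "cp_feasible A B P s r l \<longleftrightarrow>
     (l, 0) \<in> dual_cone P \<and>
     (s + transpose A *v l - l, r + transpose B *v l) \<in> dual_cone P"

definition cp_value ::
  "real^'n^'n \<Rightarrow> real^'m^'n \<Rightarrow> ((real^'n) \<times> (real^'m)) set \<Rightarrow> real^'n \<Rightarrow> real^'m \<Rightarrow> real^'n \<Rightarrow> ereal" where
  "cp_value A B P s r x0 = (SUP l \<in> {l. cp_feasible A B P s r l}. ereal (l \<bullet> x0))"

definition bellman_solution ::
  "real^'n^'n \<Rightarrow> real^'m^'n \<Rightarrow> ((real^'n) \<times> (real^'m)) set \<Rightarrow> real^'n \<Rightarrow> real^'m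
     \<Rightarrow> (real^'m \<Rightarrow> real^'n) \<Rightarrow> real^'n \<Rightarrow> bool" where
  "bellman_solution A B P s r \<phi> l \<longleftrightarrow>
     (l, 0) \<in> dual_cone P \<and> l = s + transpose A *v l + \<phi> (r + transpose B *v l)"

end

theory Submission
  imports Defs
begin

text \<open>
  On the cone, the Bellman operator \<open>T l = s + A\<^sup>T l + \<phi> (r + B\<^sup>T l)\<close> evaluates one step of dynamic
  programming on linear functions. A vector \<open>l\<close> is feasible for the convex program iff \<open>l \<le> T l\<close>
  in the order given by \<open>fst ` P\<close>. Summing this inequality along a trajectory gives weak duality,
  because a trajectory of finite cost tends to zero when \<open>(s, r)\<close> is interior to the dual cone.
  The iterates of \<open>T\<close> from \<open>0\<close> are feasible and increasing, so if the convex program is bounded they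
  converge; coercivity of the stage cost keeps the minimizing controls bounded, whence the limit
  is a fixed point. A fixed point turns the summed inequality into an equality along greedy
  trajectories.
\<close>

section \<open>Coercivity and the projection of the cone\<close>

text \<open>Tilting \<open>l\<close> by length \<open>e\<close> against the direction of
  \<open>z\<close> keeps it in the dual cone, so the tilted pairing with \<open>z\<close> is still
  nonnegative.\<close>

lemma interior_dual_cone_coercive:
  fixes P :: "'a::real_inner set"
  assumes "l \<in> interior (dual_cone P)"
  obtains e where "e > 0" "\<And>z. z \<in> P \<Longrightarrow> e * norm z \<le> l \<bullet> z"
proof -
  obtain e where e: "e > 0" "cball l e \<subseteq> dual_cone P"
    using assms mem_interior_cball by blast
  have "e * norm z \<le> l \<bullet> z" if "z \<in> P" for z
  proof (cases "z = 0")
    case False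
    let ?w = "l - (e / norm z) *\<^sub>R z"
    have "?w \<in> cball l e"
      using False e(1) by (simp add: dist_norm)
    then have "0 \<le> ?w \<bullet> z"
      using subsetD[OF e(2)] that unfolding dual_cone_def by blast
    also have "?w \<bullet> z = l \<bullet> z - e * norm z"
      using False by (simp add: inner_diff_left dot_square_norm power2_eq_square)
    finally show ?thesis by simp
  qed simp
  with e(1) show ?thesis by (rule that)
qed

lemma interior_fst_scaled_diff:
  fixes P :: "('a::real_normed_vector \<times> 'b::real_normed_vector) set"
  assumes "interior P \<noteq> {}"
  obtains e x y where "e > 0" "x \<in> fst ` P" "y \<in> fst ` P" "e *\<^sub>R w = x - y"
proof -
  obtain a b d where d: "d > 0" "cball (a, b) d \<subseteq> P"
    using assms by (metis equals0I mem_interior_cball surj_pair)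
  \<comment> \<open>The summand 1 covers \<open>w = 0\<close>; the shift
    \<open>e *\<^sub>R w\<close> still stays within radius \<open>d\<close>.\<close>
  define e where "e = d / (norm w + 1)"
  have e: "e > 0"
    using d(1) by (simp add: e_def add_nonneg_pos)
  have "e * norm w \<le> d"
    using d(1) by (simp add: e_def divide_le_eq add_nonneg_pos)
  then have "(a + e *\<^sub>R w, b) \<in> P" "(a, b) \<in> P"
    using d e by (auto simp: dist_Pair_Pair dist_norm intro!: subsetD[OF d(2)])
  then show ?thesis
    using that[OF e, of "a + e *\<^sub>R w" a] by force
qed

text \<open>Writing a multiple of \<open>k - l\<close> as a difference of projected points shows
  that \<open>k - l\<close> is orthogonal to itself.\<close>

lemma inner_eq_on_fst_imp_eq:
  fixes P :: "('a::real_inner \<times> 'b::real_normed_vector) set"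
  assumes "interior P \<noteq> {}" and eq: "\<And>x. x \<in> fst ` P \<Longrightarrow> k \<bullet> x = l \<bullet> x"
  shows "k = l"
proof -
  obtain e x y where e: "e > 0" and xy: "x \<in> fst ` P" "y \<in> fst ` P" "e *\<^sub>R (k - l) = x - y"
    using interior_fst_scaled_diff[OF assms(1)] by blast
  have "e * ((k - l) \<bullet> (k - l)) = (k - l) \<bullet> (x - y)"
    by (simp flip: xy(3))
  also have "\<dots> = 0"
    using eq[OF xy(1)] eq[OF xy(2)] by (simp add: inner_diff_left inner_diff_right)
  finally show ?thesis
    using e by simp
qed

text \<open>By linearity the pairing converges in every direction \<open>w\<close>, hence in each
  coordinate.\<close>

lemma convergent_if_inner_convergent_on_fst:
  fixes P :: "((real^'n) \<times> 'b::real_normed_vector) set" and l :: "nat \<Rightarrow> real^'n"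
  assumes "interior P \<noteq> {}" and conv: "\<And>x. x \<in> fst ` P \<Longrightarrow> convergent (\<lambda>k. l k \<bullet> x)"
  shows "convergent l"
proof -
  have "convergent (\<lambda>k. l k \<bullet> w)" for w
  proof -
    obtain e x y where e: "e > 0" and xy: "x \<in> fst ` P" "y \<in> fst ` P" "e *\<^sub>R w = x - y"
      using interior_fst_scaled_diff[OF assms(1)] by blast
    have w: "w = (1 / e) *\<^sub>R (x - y)"
      using e by (simp flip: xy(3))
    have "convergent (\<lambda>k. (1 / e) * (l k \<bullet> x - l k \<bullet> y))"
      by (intro convergent_mult convergent_const convergent_diff conv xy)
    then show ?thesis
      by (simp add: w inner_diff_right)
  qed
  from this[of "axis _ 1"] have "convergent (\<lambda>k. l k $ i)" for i
    by (simp add: inner_axis)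
  then have "(\<lambda>k. l k $ i) \<longlonglongrightarrow> (\<chi> i. lim (\<lambda>k. l k $ i)) $ i" for i
    by (simp add: convergent_LIMSEQ_iff)
  then show ?thesis
    unfolding convergent_def by (blast intro: vec_tendstoI)
qed

section \<open>The Bellman operator\<close>

locale conic_control =
  fixes P :: "((real^'n) \<times> (real^'m)) set"
    and A :: "real^'n^'n" and B :: "real^'m^'n"
    and s :: "real^'n" and r :: "real^'m"
    and \<phi> :: "real^'m \<Rightarrow> real^'n"
  assumes interior_nonempty: "interior P \<noteq> {}"
    and continuation: "(x, u) \<in> P \<Longrightarrow> \<exists>v. (A *v x + B *v u, v) \<in> P"
    and cost_interior: "(s, r) \<in> interior (dual_cone P)"
    and \<phi>_attained: "\<lbrakk>(x, v) \<in> P; (\<eta>, \<mu>) \<in> dual_cone P\<rbrakk> \<Longrightarrow>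
           \<exists>u. is_arg_min (\<lambda>u. \<mu> \<bullet> u) (\<lambda>u. (x, u) \<in> P) u \<and> \<phi> \<mu> \<bullet> x = \<mu> \<bullet> u"
begin

text \<open>One-step lookahead with cost-to-go \<open>l\<close>: up to terms in \<open>x\<close>
  alone, the objective is the stage cost plus \<open>l\<close> at the next state.\<close>

definition greedy :: "real^'n \<Rightarrow> real^'n \<Rightarrow> real^'m \<Rightarrow> bool" where
  "greedy l x = is_arg_min (\<lambda>u. (r + transpose B *v l) \<bullet> u) (\<lambda>u. (x, u) \<in> P)"

definition bellman :: "real^'n \<Rightarrow> real^'n" where
  "bellman l = s + transpose A *v l + \<phi> (r + transpose B *v l)"

lemma coercive:
  obtains e where "e > 0" "\<And>x u. (x, u) \<in> P \<Longrightarrow> e * norm (x, u) \<le> s \<bullet> x + r \<bullet> u"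
  using interior_dual_cone_coercive[OF cost_interior] by (metis inner_Pair)

lemma stage_cost_nonneg: "(x, u) \<in> P \<Longrightarrow> 0 \<le> s \<bullet> x + r \<bullet> u"
  using cost_interior interior_subset[of "dual_cone P"] by (force simp: dual_cone_def inner_Pair)

lemma dual_nonneg: "\<lbrakk>(l, 0) \<in> dual_cone P; (x, u) \<in> P\<rbrakk> \<Longrightarrow> 0 \<le> l \<bullet> x"
  by (force simp: dual_cone_def inner_Pair)

lemma dual_nonneg_next:
  "\<lbrakk>(l, 0) \<in> dual_cone P; (x, u) \<in> P\<rbrakk> \<Longrightarrow> 0 \<le> l \<bullet> (A *v x + B *v u)"
  using continuation dual_nonneg by blast

lemma one_step_cost_eq:
  "(s + transpose A *v l) \<bullet> x + (r + transpose B *v l) \<bullet> u = s \<bullet> x + r \<bullet> u + l \<bullet> (A *v x + B *v u)"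
  by (simp add: inner_add_left inner_add_right dot_lmul_matrix)

text \<open>The pairing with \<open>(x, u)\<close> is a stage cost plus \<open>l\<close> at an
  admissible next state, both nonnegative. This permits the hypothesis on \<open>\<phi>\<close> to
  be applied at \<open>r + transpose B *v l\<close>.\<close>

lemma one_step_in_dual_cone:
  "(l, 0) \<in> dual_cone P \<Longrightarrow> (s + transpose A *v l, r + transpose B *v l) \<in> dual_cone P"
  unfolding dual_cone_def
  using stage_cost_nonneg dual_nonneg_next
  by (clarsimp simp add: inner_Pair one_step_cost_eq simp del: transpose_matrix_vector)
     (smt (verit) dual_cone_def mem_Collect_eq)

text \<open>All minimizers have the same objective value, so \<open>u\<close> may replace the one
  supplied with \<open>\<phi>\<close>.\<close>

lemma bellman_greedy:
  assumes l: "(l, 0) \<in> dual_cone P" and u: "greedy l x u"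
  shows "bellman l \<bullet> x = s \<bullet> x + r \<bullet> u + l \<bullet> (A *v x + B *v u)"
proof -
  have "(x, u) \<in> P"
    using u by (simp add: greedy_def is_arg_min_linorder)
  then obtain w where "greedy l x w" "\<phi> (r + transpose B *v l) \<bullet> x = (r + transpose B *v l) \<bullet> w"
    using \<phi>_attained[OF _ one_step_in_dual_cone[OF l]] greedy_def by metis
  with u have "\<phi> (r + transpose B *v l) \<bullet> x = (r + transpose B *v l) \<bullet> u"
    unfolding greedy_def is_arg_min_linorder by (metis order_antisym)
  then have "bellman l \<bullet> x = (s + transpose A *v l) \<bullet> x + (r + transpose B *v l) \<bullet> u"
    by (simp add: bellman_def inner_add_left)
  then show ?thesis
    unfolding one_step_cost_eq .
qed

lemma greedy_exists:
  "\<lbrakk>(l, 0) \<in> dual_cone P; (x, v) \<in> P\<rbrakk> \<Longrightarrow> \<exists>u. greedy l x u"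
  using \<phi>_attained[OF _ one_step_in_dual_cone] unfolding greedy_def by blast

lemma greedy_iff:
  assumes l: "(l, 0) \<in> dual_cone P" and xu: "(x, u) \<in> P"
  shows "greedy l x u \<longleftrightarrow> s \<bullet> x + r \<bullet> u + l \<bullet> (A *v x + B *v u) \<le> bellman l \<bullet> x"
proof
  assume le: "s \<bullet> x + r \<bullet> u + l \<bullet> (A *v x + B *v u) \<le> bellman l \<bullet> x"
  obtain w where w: "greedy l x w"
    using greedy_exists assms by blast
  with le have "(s + transpose A *v l) \<bullet> x + (r + transpose B *v l) \<bullet> u
      \<le> (s + transpose A *v l) \<bullet> x + (r + transpose B *v l) \<bullet> w"
    unfolding one_step_cost_eq using bellman_greedy[OF l w] by simp
  with w xu show "greedy l x u"
    unfolding greedy_def is_arg_min_linorder by force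
qed (use bellman_greedy[OF l] in simp)

text \<open>A control violating the bound would be greedy by \<open>greedy_iff\<close>, and greedy
  controls give equality.\<close>

lemma bellman_le:
  assumes l: "(l, 0) \<in> dual_cone P" and xu: "(x, u) \<in> P"
  shows "bellman l \<bullet> x \<le> s \<bullet> x + r \<bullet> u + l \<bullet> (A *v x + B *v u)"
  using greedy_iff[OF assms] bellman_greedy[OF l] by fastforce

section \<open>Feasibility for the convex program\<close>

text \<open>Moving the transposes onto the dynamics turns the second dual-cone constraint into an
  inequality that telescopes along trajectories.\<close>

lemma cp_feasible_iff:
  "cp_feasible A B P s r l \<longleftrightarrow>
     (l, 0) \<in> dual_cone P \<and> (\<forall>(x, u)\<in>P. l \<bullet> x \<le> s \<bullet> x + r \<bullet> u + l \<bullet> (A *v x + B *v u))"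
proof -
  have "(s + transpose A *v l - l, r + transpose B *v l) \<in> dual_cone P \<longleftrightarrow>
      (\<forall>(x, u)\<in>P. 0 \<le> (s + transpose A *v l) \<bullet> x + (r + transpose B *v l) \<bullet> u - l \<bullet> x)"
    by (auto simp: dual_cone_def inner_Pair inner_diff_left algebra_simps)
  then show ?thesis
    unfolding cp_feasible_def one_step_cost_eq by auto
qed

text \<open>For fixed \<open>x\<close>, the right side of the one-step inequality has minimum
  \<open>bellman l \<bullet> x\<close>, attained by a greedy control.\<close>

lemma cp_feasible_iff_le_bellman:
  "cp_feasible A B P s r l \<longleftrightarrow>
     (l, 0) \<in> dual_cone P \<and> (\<forall>(x, u)\<in>P. l \<bullet> x \<le> bellman l \<bullet> x)"
proof (cases "(l, 0) \<in> dual_cone P")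
  case True
  have "(\<forall>u. (x, u) \<in> P \<longrightarrow> l \<bullet> x \<le> s \<bullet> x + r \<bullet> u + l \<bullet> (A *v x + B *v u)) \<longleftrightarrow>
      (\<forall>u. (x, u) \<in> P \<longrightarrow> l \<bullet> x \<le> bellman l \<bullet> x)" for x
  proof safe
    fix u assume "\<forall>u. (x, u) \<in> P \<longrightarrow> l \<bullet> x \<le> s \<bullet> x + r \<bullet> u + l \<bullet> (A *v x + B *v u)"
      and "(x, u) \<in> P"
    moreover obtain w where w: "greedy l x w"
      using greedy_exists[OF True \<open>(x, u) \<in> P\<close>] by blast
    moreover have "(x, w) \<in> P"
      using w by (simp add: greedy_def is_arg_min_linorder)
    ultimately show "l \<bullet> x \<le> bellman l \<bullet> x"
      using bellman_greedy[OF True w] by simp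
  qed (use bellman_le[OF True] in fastforce)
  with True show ?thesis
    unfolding cp_feasible_iff by blast
qed (simp add: cp_feasible_iff)

lemma bellman_in_dual_cone:
  assumes "(l, 0) \<in> dual_cone P"
  shows "(bellman l, 0) \<in> dual_cone P"
proof -
  have "0 \<le> bellman l \<bullet> x" if xu: "(x, u) \<in> P" for x u
  proof -
    obtain w where w: "greedy l x w"
      using greedy_exists assms xu by blast
    then have "(x, w) \<in> P"
      by (simp add: greedy_def is_arg_min_linorder)
    then show ?thesis
      using bellman_greedy[OF assms w] stage_cost_nonneg dual_nonneg_next[OF assms] by fastforce
  qed
  then show ?thesis
    by (auto simp: dual_cone_def inner_Pair)
qed

text \<open>The greedy control for \<open>l\<close> is admissible in the minimization for
  \<open>k\<close>, and \<open>continuation\<close> puts its next state where \<open>k\<close> and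
  \<open>l\<close> are comparable.\<close>

lemma bellman_mono:
  assumes "(k, 0) \<in> dual_cone P" "(l, 0) \<in> dual_cone P"
    and le: "\<And>x u. (x, u) \<in> P \<Longrightarrow> k \<bullet> x \<le> l \<bullet> x" and xu: "(x, u) \<in> P"
  shows "bellman k \<bullet> x \<le> bellman l \<bullet> x"
proof -
  obtain w where w: "greedy l x w"
    using greedy_exists assms by blast
  then have xw: "(x, w) \<in> P"
    by (simp add: greedy_def is_arg_min_linorder)
  then obtain v where "(A *v x + B *v w, v) \<in> P"
    using continuation by blast
  then have "k \<bullet> (A *v x + B *v w) \<le> l \<bullet> (A *v x + B *v w)"
    by (rule le)
  then show ?thesis
    using bellman_le[OF assms(1) xw] bellman_greedy[OF assms(2) w] by simp
qed

lemma cp_feasible_bellman: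
  assumes "cp_feasible A B P s r l"
  shows "cp_feasible A B P s r (bellman l)"
proof -
  have l: "(l, 0) \<in> dual_cone P" "\<And>x u. (x, u) \<in> P \<Longrightarrow> l \<bullet> x \<le> bellman l \<bullet> x"
    using assms unfolding cp_feasible_iff_le_bellman by auto
  with bellman_in_dual_cone bellman_mono[of l "bellman l"] show ?thesis
    unfolding cp_feasible_iff_le_bellman by blast
qed

lemma cp_feasible_zero: "cp_feasible A B P s r 0"
  using stage_cost_nonneg by (auto simp: cp_feasible_iff dual_cone_def)

lemma cp_feasible_iterate: "cp_feasible A B P s r ((bellman ^^ k) 0)"
  by (induction k) (simp_all add: cp_feasible_zero cp_feasible_bellman)

lemma bellman_solution_iff:
  "bellman_solution A B P s r \<phi> l \<longleftrightarrow> (l, 0) \<in> dual_cone P \<and> bellman l = l"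
  by (auto simp: bellman_solution_def bellman_def)

lemma bellman_solution_cp_feasible:
  "bellman_solution A B P s r \<phi> l \<Longrightarrow> cp_feasible A B P s r l"
  by (simp add: bellman_solution_iff cp_feasible_iff_le_bellman split_beta)

section \<open>Convergence of value iteration\<close>

lemma cp_bounded_imp_bellman_solution:
  assumes bounded: "\<And>x u. (x, u) \<in> P \<Longrightarrow> cp_value A B P s r x \<noteq> \<infinity>"
  shows "\<exists>l. bellman_solution A B P s r \<phi> l"
proof -
  define l where "l k = (bellman ^^ k) 0" for k
  have l_Suc: "l (Suc k) = bellman (l k)" for k
    by (simp add: l_def)
  have feas: "cp_feasible A B P s r (l k)" for k
    unfolding l_def by (rule cp_feasible_iterate)
  then have dual: "(l k, 0) \<in> dual_cone P" for k
    by (simp add: cp_feasible_def)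
  have mono: "incseq (\<lambda>k. l k \<bullet> x)" if "(x, u) \<in> P" for x u
    using feas that unfolding cp_feasible_iff_le_bellman by (intro incseq_SucI) (fastforce simp: l_Suc)
  have "convergent (\<lambda>k. l k \<bullet> x)" if x: "x \<in> fst ` P" for x
  proof -
    obtain u where xu: "(x, u) \<in> P"
      using x by auto
    have le: "ereal (l k \<bullet> x) \<le> cp_value A B P s r x" for k
      unfolding cp_value_def using feas by (auto intro: SUP_upper)
    \<comment> \<open>A feasible iterate excludes the value minus infinity, and the hypothesis
      excludes plus infinity.\<close>
    then obtain c where "cp_value A B P s r x = ereal c"
      using bounded[OF xu] by (cases "cp_value A B P s r x") auto
    with le have "\<forall>k. l k \<bullet> x \<le> c"
      by simp
    then show ?thesis
      using incseq_convergent[OF mono[OF xu]] convergentI by metis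
  qed
  then obtain L where L: "l \<longlonglongrightarrow> L"
    using convergent_if_inner_convergent_on_fst[OF interior_nonempty] convergent_def by metis
  have lim: "(\<lambda>k. l k \<bullet> x) \<longlonglongrightarrow> L \<bullet> x" for x
    by (intro tendsto_inner L tendsto_const)
  have upper: "l k \<bullet> x \<le> L \<bullet> x" if "(x, u) \<in> P" for k x u
    using incseq_le[OF mono[OF that] lim] .
  have L_dual: "(L, 0) \<in> dual_cone P"
  proof -
    have "0 \<le> L \<bullet> x" if "(x, u) \<in> P" for x u
      using dual_nonneg[OF dual that] upper[OF that] by (rule order_trans)
    then show ?thesis
      by (auto simp: dual_cone_def inner_Pair)
  qed
  have "bellman L \<bullet> x = L \<bullet> x" if x: "x \<in> fst ` P" for x
  proof (rule antisym)
    obtain v where xv: "(x, v) \<in> P"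
      using x by auto
    have "l (Suc k) \<bullet> x \<le> bellman L \<bullet> x" for k
      unfolding l_Suc using bellman_mono[OF dual L_dual upper xv] .
    then show "L \<bullet> x \<le> bellman L \<bullet> x"
      using LIMSEQ_le_const2[OF LIMSEQ_Suc[OF lim]] by blast
    \<comment> \<open>For the reverse inequality, each \<open>l k\<close> gets its own minimizing
      control. Convergence of \<open>u\<close> is not claimed; boundedness suffices.\<close>
    obtain u where u: "\<And>k. greedy (l k) x (u k)"
      using greedy_exists[OF dual xv] by metis
    then have xu: "(x, u k) \<in> P" for k
      by (simp add: greedy_def is_arg_min_linorder)
    have step: "l (Suc k) \<bullet> x = s \<bullet> x + r \<bullet> u k + l k \<bullet> (A *v x + B *v u k)" for k
      unfolding l_Suc using bellman_greedy[OF dual u] .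
    obtain e where e: "e > 0" "\<And>x u. (x, u) \<in> P \<Longrightarrow> e * norm (x, u) \<le> s \<bullet> x + r \<bullet> u"
      using coercive by blast
    have "norm (u k) \<le> (L \<bullet> x) / e" for k
    proof -
      have "e * norm (u k) \<le> e * norm (x, u k)"
        using e(1) norm_snd_le[of "u k" x] by simp
      also have "\<dots> \<le> s \<bullet> x + r \<bullet> u k"
        using e(2) xu .
      also have "\<dots> \<le> l (Suc k) \<bullet> x"
        using step dual_nonneg_next[OF dual xu] by simp
      also have "\<dots> \<le> L \<bullet> x"
        using upper[OF xv] .
      finally show ?thesis
        using e(1) by (simp add: field_simps)
    qed
    then have bdd: "Bfun u sequentially"
      by (intro BfunI always_eventually) blast
    have "(\<lambda>k. L - l k) \<longlonglongrightarrow> 0"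
      using tendsto_diff[OF tendsto_const L, of L] by simp
    then have "(\<lambda>k. transpose B *v (L - l k)) \<longlonglongrightarrow> transpose B *v 0"
      by (rule bounded_linear.tendsto[OF matrix_vector_mul_bounded_linear])
    \<comment> \<open>A null sequence paired with a bounded one is null.\<close>
    then have "Zfun (\<lambda>k. (transpose B *v (L - l k)) \<bullet> u k) sequentially"
      by (intro bounded_bilinear.Zfun_prod_Bfun[OF bounded_bilinear_inner _ bdd])
         (simp add: tendsto_Zfun_iff)
    then have "(\<lambda>k. (L - l k) \<bullet> (B *v u k)) \<longlonglongrightarrow> 0"
      by (simp add: tendsto_Zfun_iff dot_lmul_matrix)
    then have "(\<lambda>k. l (Suc k) \<bullet> x + ((L - l k) \<bullet> (A *v x) + (L - l k) \<bullet> (B *v u k)))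
        \<longlonglongrightarrow> L \<bullet> x + ((L - L) \<bullet> (A *v x) + 0)"
      by (intro tendsto_intros LIMSEQ_Suc[OF lim] L)
    \<comment> \<open>Using \<open>u k\<close> as a trial control for \<open>L\<close> costs
      \<open>l (Suc k) \<bullet> x\<close> plus the error from replacing \<open>l k\<close> by
      \<open>L\<close> at the next state; this error vanishes in the limit.\<close>
    moreover have "bellman L \<bullet> x
        \<le> l (Suc k) \<bullet> x + ((L - l k) \<bullet> (A *v x) + (L - l k) \<bullet> (B *v u k))" for k
      using bellman_le[OF L_dual xu, of k] step[of k]
      by (simp add: inner_diff_left inner_add_right)
    ultimately show "bellman L \<bullet> x \<le> L \<bullet> x"
      using LIMSEQ_le_const by force
  qed
  then have "bellman L = L"
    by (rule inner_eq_on_fst_imp_eq[OF interior_nonempty])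
  with L_dual show ?thesis
    unfolding bellman_solution_iff by blast
qed

section \<open>Weak duality\<close>

lemma oc_feasible_cost_nonneg:
  "oc_feasible A B P x0 (x, u) \<Longrightarrow> 0 \<le> s \<bullet> x t + r \<bullet> u t"
  using stage_cost_nonneg by (simp add: oc_feasible_def)

lemma cp_feasible_le_oc_cost:
  assumes l: "cp_feasible A B P s r l" and z: "oc_feasible A B P x0 z"
  shows "ereal (l \<bullet> x0) \<le> oc_cost s r z"
proof -
  obtain x u where z_eq: "z = (x, u)"
    by fastforce
  define c where "c t = s \<bullet> x t + r \<bullet> u t" for t
  have cost: "oc_cost s r z = (\<Sum>t. ereal (c t))"
    by (simp add: oc_cost_def c_def z_eq)
  have c: "0 \<le> c t" for t
    using oc_feasible_cost_nonneg z by (simp add: z_eq c_def)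
  have x0: "x 0 = x0" and P: "(x t, u t) \<in> P" and dyn: "x (Suc t) = A *v x t + B *v u t" for t
    using z by (auto simp: oc_feasible_def z_eq)
  show ?thesis
  proof (cases "(\<Sum>t. ereal (c t)) = \<infinity>")
    case False
    have sm: "summable c"
      using summable_ereal[OF c False] .
    obtain e where e: "e > 0" "\<And>x u. (x, u) \<in> P \<Longrightarrow> e * norm (x, u) \<le> s \<bullet> x + r \<bullet> u"
      using coercive by blast
    \<comment> \<open>Summable stage costs tend to zero, so coercivity drives the state to zero and
      removes the terminal term \<open>l \<bullet> x N\<close>.\<close>
    have "norm (x t) \<le> c t / e" for t
    proof -
      have "e * norm (x t) \<le> e * norm (x t, u t)"
        using e(1) norm_fst_le[of "x t" "u t"] by simp
      also have "\<dots> \<le> c t"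
        unfolding c_def using e(2) P .
      finally show ?thesis
        using e(1) by (simp add: field_simps)
    qed
    moreover have "(\<lambda>t. c t / e) \<longlonglongrightarrow> 0"
      using tendsto_divide_zero[OF summable_LIMSEQ_zero[OF sm]] .
    ultimately have "x \<longlonglongrightarrow> 0"
      by (intro Lim_null_comparison[of x "\<lambda>t. c t / e"] always_eventually allI)
    then have lim: "(\<lambda>N. l \<bullet> x0 - l \<bullet> x N) \<longlonglongrightarrow> l \<bullet> x0 - l \<bullet> 0"
      by (intro tendsto_intros)
    \<comment> \<open>Each stage cost is at least the decrease of \<open>l\<close> along that step;
      these decreases telescope.\<close>
    have "l \<bullet> x0 - l \<bullet> x N \<le> (\<Sum>t<N. c t)" for N
    proof (induction N)
      case (Suc N)
      have "l \<bullet> x N \<le> c N + l \<bullet> x (Suc N)"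
        using l P[of N] unfolding cp_feasible_iff c_def dyn by fast
      with Suc.IH show ?case
        by simp
    qed (simp add: x0)
    also have "(\<Sum>t<N. c t) \<le> suminf c" for N
      by (rule sum_le_suminf[OF sm]) (use c in auto)
    finally have "l \<bullet> x0 - l \<bullet> x N \<le> suminf c" for N .
    then have "l \<bullet> x0 \<le> suminf c"
      using LIMSEQ_le_const2[OF lim] by auto
    then show ?thesis
      by (simp add: cost suminf_ereal[OF c False])
  qed (simp add: cost)
qed

lemma cp_value_le_oc_value: "cp_value A B P s r x0 \<le> oc_value A B P s r x0"
  unfolding cp_value_def oc_value_def
  by (intro SUP_least INF_greatest) (auto intro: cp_feasible_le_oc_cost)

text \<open>Since zero is feasible, finiteness of the value is only a question of boundedness
  above.\<close>

lemma cp_value_nonneg: "0 \<le> cp_value A B P s r x0"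
  unfolding cp_value_def using cp_feasible_zero by (auto intro!: SUP_upper2[of 0])

section \<open>Optimal trajectories and control laws\<close>

context
  fixes l assumes solution: "bellman_solution A B P s r \<phi> l"
begin

lemma solution_dual: "(l, 0) \<in> dual_cone P" and solution_fixpoint: "bellman l = l"
  using solution by (auto simp: bellman_solution_iff)

text \<open>For a fixed point and a greedy control, the stage cost is exactly the decrease of
  \<open>l\<close> along the step, so the partial sums telescope.\<close>

lemma greedy_trajectory:
  assumes \<kappa>: "\<forall>(x, v)\<in>P. greedy l x (\<kappa> x)" and x0: "(x0, u0) \<in> P"
  defines "x \<equiv> closed_loop A B \<kappa> x0"
  shows "oc_feasible A B P x0 (x, \<lambda>t. \<kappa> (x t))"
    and "oc_cost s r (x, \<lambda>t. \<kappa> (x t)) = ereal (l \<bullet> x0)"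
proof -
  have P: "(y, v) \<in> P \<Longrightarrow> (y, \<kappa> y) \<in> P" for y v
    using \<kappa> unfolding greedy_def is_arg_min_linorder by blast
  have xP: "(x t, \<kappa> (x t)) \<in> P" for t
  proof (induction t)
    case 0
    then show ?case using P[OF x0] by (simp add: x_def)
  next
    case (Suc t)
    then obtain v where "(x (Suc t), v) \<in> P"
      using continuation unfolding x_def by fastforce
    then show ?case by (rule P)
  qed
  then show feas: "oc_feasible A B P x0 (x, \<lambda>t. \<kappa> (x t))"
    by (simp add: oc_feasible_def x_def)
  have step: "s \<bullet> x t + r \<bullet> \<kappa> (x t) = l \<bullet> x t - l \<bullet> x (Suc t)" for t
    using bellman_greedy[OF solution_dual, of "x t" "\<kappa> (x t)"] \<kappa> xP[of t]
    by (auto simp: solution_fixpoint x_def)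
  \<comment> \<open>Dropping the nonnegative terminal term bounds the cost from above; weak duality
    supplies the lower bound.\<close>
  have "(\<Sum>t<N. s \<bullet> x t + r \<bullet> \<kappa> (x t)) \<le> l \<bullet> x0" for N
  proof -
    have "(\<Sum>t<N. s \<bullet> x t + r \<bullet> \<kappa> (x t)) = l \<bullet> x0 - l \<bullet> x N"
      unfolding step sum_lessThan_telescope'[of "\<lambda>t. l \<bullet> x t"] by (simp add: x_def)
    then show ?thesis
      using dual_nonneg[OF solution_dual xP, of N] by simp
  qed
  then have "oc_cost s r (x, \<lambda>t. \<kappa> (x t)) \<le> ereal (l \<bullet> x0)"
    unfolding oc_cost_def prod.case
    by (intro suminf_bound allI) (simp_all add: oc_feasible_cost_nonneg[OF feas])
  then show "oc_cost s r (x, \<lambda>t. \<kappa> (x t)) = ereal (l \<bullet> x0)"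
    using cp_feasible_le_oc_cost[OF bellman_solution_cp_feasible[OF solution] feas] by simp
qed

lemma greedy_law_exists: "\<exists>\<kappa>. \<forall>(x, v)\<in>P. greedy l x (\<kappa> x)"
  using greedy_exists[OF solution_dual] by (intro exI[of _ "\<lambda>x. SOME u. greedy l x u"]) (auto intro: someI_ex)

text \<open>The lower bound \<open>l \<bullet> x0\<close> from weak duality is attained by a greedy
  trajectory, hence it is the minimum.\<close>

lemma oc_optimal_iff:
  assumes "(x0, u0) \<in> P"
  shows "oc_optimal A B P s r x0 z \<longleftrightarrow>
     oc_feasible A B P x0 z \<and> oc_cost s r z = ereal (l \<bullet> x0)"
proof -
  note lower = cp_feasible_le_oc_cost[OF bellman_solution_cp_feasible[OF solution]]
  obtain \<kappa> where "\<forall>(x, v)\<in>P. greedy l x (\<kappa> x)"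
    using greedy_law_exists by blast
  from greedy_trajectory[OF this assms] obtain y
    where "oc_feasible A B P x0 y" "oc_cost s r y = ereal (l \<bullet> x0)"
    by blast
  then show ?thesis
    unfolding oc_optimal_def is_arg_min_linorder by (metis lower order_antisym)
qed

lemma oc_optimal_exists:
  assumes "(x0, u0) \<in> P"
  shows "\<exists>z. oc_optimal A B P s r x0 z"
proof -
  obtain \<kappa> where "\<forall>(x, v)\<in>P. greedy l x (\<kappa> x)"
    using greedy_law_exists by blast
  from greedy_trajectory[OF this assms] show ?thesis
    unfolding oc_optimal_iff[OF assms] by blast
qed

lemma oc_value_eq:
  assumes "(x0, u0) \<in> P"
  shows "oc_value A B P s r x0 = ereal (l \<bullet> x0)"
proof -
  obtain z where z: "oc_feasible A B P x0 z" "oc_cost s r z = ereal (l \<bullet> x0)"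
    using oc_optimal_exists[OF assms] oc_optimal_iff[OF assms] by blast
  show ?thesis
  proof (rule antisym)
    show "oc_value A B P s r x0 \<le> ereal (l \<bullet> x0)"
      unfolding oc_value_def using z by (auto intro: INF_lower2[of z])
    show "ereal (l \<bullet> x0) \<le> oc_value A B P s r x0"
      unfolding oc_value_def
      using cp_feasible_le_oc_cost[OF bellman_solution_cp_feasible[OF solution]]
      by (auto intro: INF_greatest)
  qed
qed

lemma cp_value_eq:
  assumes "(x0, u0) \<in> P"
  shows "cp_value A B P s r x0 = ereal (l \<bullet> x0)"
proof (rule antisym)
  show "cp_value A B P s r x0 \<le> ereal (l \<bullet> x0)"
    using cp_value_le_oc_value oc_value_eq[OF assms] by metis
  show "ereal (l \<bullet> x0) \<le> cp_value A B P s r x0"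
    unfolding cp_value_def
    using bellman_solution_cp_feasible[OF solution] by (auto intro: SUP_upper)
qed

lemma cp_arg_max:
  assumes "(x0, u0) \<in> P"
  shows "is_arg_max (\<lambda>k. k \<bullet> x0) (cp_feasible A B P s r) l"
proof -
  have "ereal (k \<bullet> x0) \<le> ereal (l \<bullet> x0)" if "cp_feasible A B P s r k" for k
    using that unfolding cp_value_eq[OF assms, symmetric] cp_value_def by (auto intro: SUP_upper)
  then show ?thesis
    using bellman_solution_cp_feasible[OF solution] by (simp add: is_arg_max_linorder)
qed

text \<open>Principle of optimality: the tail costs at least \<open>l\<close> at the second state,
  so the total \<open>l \<bullet> x0\<close> leaves no room for a first control that is not
  greedy.\<close>

lemma optimal_imp_first_greedy:
  assumes x0: "(x0, u0) \<in> P" and opt: "oc_optimal A B P s r x0 (x, u)"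
  shows "greedy l x0 (u 0)"
proof -
  have feas: "oc_feasible A B P x0 (x, u)" and cost: "oc_cost s r (x, u) = ereal (l \<bullet> x0)"
    using opt oc_optimal_iff[OF x0] by auto
  then have P: "(x0, u 0) \<in> P" and x: "x 0 = x0" "x (Suc 0) = A *v x0 + B *v u 0"
    by (auto simp: oc_feasible_def)
  define c where "c t = s \<bullet> x t + r \<bullet> u t" for t
  have c: "0 \<le> c t" for t
    unfolding c_def using oc_feasible_cost_nonneg[OF feas] .
  have sum_c: "(\<Sum>t. ereal (c t)) = ereal (l \<bullet> x0)"
    using cost by (simp add: oc_cost_def c_def)
  then have sm: "summable c"
    using c by (intro summable_ereal) auto
  \<comment> \<open>The shifted trajectory is admissible from the second state, so weak duality
    applies to it.\<close>
  have "oc_feasible A B P (x (Suc 0)) (\<lambda>t. x (Suc t), \<lambda>t. u (Suc t))"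
    using feas unfolding oc_feasible_def prod.case by blast
  from cp_feasible_le_oc_cost[OF bellman_solution_cp_feasible[OF solution] this]
  have "ereal (l \<bullet> x (Suc 0)) \<le> (\<Sum>t. ereal (c (Suc t)))"
    by (simp add: oc_cost_def c_def)
  also have "\<dots> = ereal (suminf c - c 0)"
    using suminf_ereal'[of "\<lambda>t. c (Suc t)"] sm suminf_split_head[OF sm]
    by (simp add: summable_Suc_iff)
  also have "suminf c = l \<bullet> x0"
    using sum_c suminf_ereal'[OF sm] by simp
  finally have "c 0 + l \<bullet> (A *v x0 + B *v u 0) \<le> l \<bullet> x0"
    by (simp add: x)
  then show ?thesis
    unfolding greedy_iff[OF solution_dual P] by (simp add: c_def x solution_fixpoint)
qed

lemma optimal_control_law_iff:
  "optimal_control_law A B P s r \<kappa> \<longleftrightarrow> (\<forall>(x, v)\<in>P. greedy l x (\<kappa> x))"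
proof
  assume opt: "optimal_control_law A B P s r \<kappa>"
  have "greedy l x0 (\<kappa> x0)" if "(x0, u0) \<in> P" for x0 u0
    using optimal_imp_first_greedy[OF that] opt that
    unfolding optimal_control_law_def by fastforce
  then show "\<forall>(x, v)\<in>P. greedy l x (\<kappa> x)"
    by blast
next
  assume \<kappa>: "\<forall>(x, v)\<in>P. greedy l x (\<kappa> x)"
  show "optimal_control_law A B P s r \<kappa>"
    unfolding optimal_control_law_def
    using greedy_trajectory[OF \<kappa>] oc_optimal_iff by blast
qed

end

end

section \<open>Equivalence of the three statements and optimality\<close>

theorem theorem1:
  fixes P :: "((real^'n) \<times> (real^'m)) set"
    and A :: "real^'n^'n" and B :: "real^'m^'n"
    and s :: "real^'n" and r :: "real^'m"
    and \<phi> :: "real^'m \<Rightarrow> real^'n"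
  assumes "proper_cone P"
    and "\<forall>(x, u)\<in>P. \<exists>v. (A *v x + B *v u, v) \<in> P"
    and "(s, r) \<in> interior (dual_cone P)"
    and "\<forall>(x, v)\<in>P. \<forall>(\<eta>, \<mu>)\<in>dual_cone P.
           \<exists>u. is_arg_min (\<lambda>u. \<mu> \<bullet> u) (\<lambda>u. (x, u) \<in> P) u \<and> \<phi> \<mu> \<bullet> x = \<mu> \<bullet> u"
  shows "((\<forall>(x0, u0)\<in>P. \<bar>oc_value A B P s r x0\<bar> \<noteq> \<infinity>) \<longleftrightarrow>
            (\<exists>l. bellman_solution A B P s r \<phi> l)) \<and>
         ((\<exists>l. bellman_solution A B P s r \<phi> l) \<longleftrightarrow>
            (\<forall>(x0, u0)\<in>P. \<bar>cp_value A B P s r x0\<bar> \<noteq> \<infinity>)) \<and>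
         (\<forall>l. bellman_solution A B P s r \<phi> l \<longrightarrow>
            (\<forall>(x0, u0)\<in>P.
               oc_value A B P s r x0 = ereal (l \<bullet> x0) \<and>
               (\<exists>z. oc_optimal A B P s r x0 z) \<and>
               cp_value A B P s r x0 = ereal (l \<bullet> x0) \<and>
               (\<exists>k. is_arg_max (\<lambda>k. k \<bullet> x0) (cp_feasible A B P s r) k)) \<and>
            (\<exists>\<kappa>. optimal_control_law A B P s r \<kappa>) \<and>
            (\<forall>\<kappa>. optimal_control_law A B P s r \<kappa> \<longleftrightarrow>
               (\<forall>(x, v)\<in>P.
                  is_arg_min (\<lambda>u. (r + transpose B *v l) \<bullet> u) (\<lambda>u. (x, u) \<in> P) (\<kappa> x))))"
proof -
  interpret conic_control P A B s r \<phi>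
    using assms by unfold_locales (auto simp: proper_cone_def)
  let ?OC = "\<forall>(x0, u0)\<in>P. \<bar>oc_value A B P s r x0\<bar> \<noteq> \<infinity>"
  let ?CP = "\<forall>(x0, u0)\<in>P. \<bar>cp_value A B P s r x0\<bar> \<noteq> \<infinity>"
  let ?sol = "\<exists>l. bellman_solution A B P s r \<phi> l"
  \<comment> \<open>The equivalences follow from the cycle (ii), (i), (iii), (ii).\<close>
  have sol_OC: "?sol \<Longrightarrow> ?OC"
    using oc_value_eq by fastforce
  have OC_CP: "?OC \<Longrightarrow> ?CP"
  proof clarify
    fix x0 u0
    assume "?OC" "(x0, u0) \<in> P" and cp: "\<bar>cp_value A B P s r x0\<bar> = \<infinity>"
    then have "\<bar>oc_value A B P s r x0\<bar> \<noteq> \<infinity>"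
      by fastforce
    \<comment> \<open>The program value lies between zero and the finite value of the control
      problem.\<close>
    with cp show False
      using cp_value_le_oc_value[of x0] cp_value_nonneg[of x0] by auto
  qed
  have CP_sol: "?CP \<Longrightarrow> ?sol"
    by (rule cp_bounded_imp_bellman_solution) fastforce
  show ?thesis
  proof (intro conjI allI impI)
    show "?OC \<longleftrightarrow> ?sol"
      using sol_OC OC_CP CP_sol by argo
    show "?sol \<longleftrightarrow> ?CP"
      using sol_OC OC_CP CP_sol by argo
  next
    fix l assume sol: "bellman_solution A B P s r \<phi> l"
    show "\<forall>(x0, u0)\<in>P.
        oc_value A B P s r x0 = ereal (l \<bullet> x0) \<and>
        (\<exists>z. oc_optimal A B P s r x0 z) \<and>
        cp_value A B P s r x0 = ereal (l \<bullet> x0) \<and>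
        (\<exists>k. is_arg_max (\<lambda>k. k \<bullet> x0) (cp_feasible A B P s r) k)"
      using oc_value_eq[OF sol] oc_optimal_exists[OF sol] cp_value_eq[OF sol] cp_arg_max[OF sol]
      by blast
    show "\<exists>\<kappa>. optimal_control_law A B P s r \<kappa>"
      unfolding optimal_control_law_iff[OF sol] by (rule greedy_law_exists[OF sol])
    show "optimal_control_law A B P s r \<kappa> \<longleftrightarrow>
        (\<forall>(x, v)\<in>P. is_arg_min (\<lambda>u. (r + transpose B *v l) \<bullet> u) (\<lambda>u. (x, u) \<in> P) (\<kappa> x))" for \<kappa>
      using optimal_control_law_iff[OF sol] unfolding greedy_def .
  qed
qed

end
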